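(* Let $f,g\in{\rm elh}(\mathbb{C})$. Then $A(f\circ g)=A(f)\cup f(A(g))$.
   Context: ${\rm elh}(\mathbb{C})$ denotes the set of entire functions $f:\mathbb{C}\to\mathbb{C}$ such that $f'(z)\neq 0$ for all $z\in\mathbb{C}$ and $f'(0)=1$. For an entire function $f$, its asymptotic variety is $A(f)=\{\alpha\in\mathbb{C}\,:\,\exists\,\gamma:[0,\infty)\to\mathbb{C}$ continuous with $\lim_{t\to\infty}|\gamma(t)|=\infty$ and $\lim_{t\to\infty}f(\gamma(t))=\alpha\}$. *)

theory Defs
  imports "HOL-Complex_Analysis.Complex_Analysis"
begin

definition elh :: "(complex \<Rightarrow> complex) set" where
  "elh = {f. f holomorphic_on UNIV \<and> (\<forall>z. deriv f z \<noteq> 0) \<and> deriv f 0 = 1}"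

definition asymptotic_variety :: "(complex \<Rightarrow> complex) \<Rightarrow> complex set" where
  "asymptotic_variety f = {\<alpha>. \<exists>\<gamma> :: real \<Rightarrow> complex.
      continuous_on {0..} \<gamma> \<and>
      filterlim (\<lambda>t. norm (\<gamma> t)) at_top at_top \<and>
      ((\<lambda>t. f (\<gamma> t)) \<longlongrightarrow> \<alpha>) at_top}"

end

theory Submission
  imports Defs
begin

text \<open>
  If $f(g(\gamma))$ tends to $\alpha$, the limit set of the curve $g(\gamma)$ on the Riemann sphere is
  connected and its finite part lies in the discrete set $f^{-1}(\alpha)$, so $g(\gamma)$ tends to
  infinity or to a single point; this gives the inclusion from left to right.

  The nontrivial part of the converse is $A(f) \subseteq A(f \circ g)$. A curve along which $f$ tends
  to $\alpha$ need not lift through $g$, since it may meet asymptotic values of $g$. It is replaced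
  by the decreasing tracts $U_n$ of $f$ over shrinking discs about $\alpha$. By an Iversen-type
  density property, every component of $g^{-1}(U)$ has dense image in a domain $U$, so one
  can choose components of the $g^{-1}(U_n)$ that are nested, and a curve descending through
  them is asymptotic for $f \circ g$.
\<close>

section \<open>Phragmen-Lindelof principle and density of the images of preimage components\<close>

text \<open>
  The factor $1/(z-a)$ tames the point at infinity in the maximum principle for $h^n/(z-a)$;
  its effect disappears on letting $n \to \infty$.
\<close>
lemma phragmen_lindelof_unbounded:
  fixes h :: "complex \<Rightarrow> complex"
  assumes "open V" and hol: "h holomorphic_on V" and cont: "continuous_on (closure V) h"
    and bound: "\<And>z. z \<in> closure V \<Longrightarrow> norm (h z) \<le> B"
    and front: "\<And>z. z \<in> frontier V \<Longrightarrow> norm (h z) \<le> M"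
    and "M > 0" and "r > 0" and away: "ball a r \<inter> V = {}" and "w \<in> V"
  shows "norm (h w) \<le> M"
proof (rule ccontr)
  assume "\<not> norm (h w) \<le> M"
  hence q: "norm (h w) / M > 1" using \<open>M > 0\<close> by simp
  have dist_a: "r \<le> norm (z - a)" if "z \<in> closure V" for z
  proof -
    have "ball a r \<inter> closure V = {}" using away by (simp add: open_Int_closure_eq_empty)
    with that have "z \<notin> ball a r" by blast
    thus ?thesis by (simp add: dist_norm norm_minus_commute)
  qed
  have power_le: "(norm (h w) / M) ^ n \<le> norm (w - a) / r" for n
  proof -
    \<comment> \<open>\<open>C\<close> bounds the modulus of \<open>k\<close> on
      \<open>frontier V\<close>, where \<open>h\<close> is at most \<open>M\<close> and
      \<open>z\<close> is at distance at least \<open>r\<close> from \<open>a\<close>. The radius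
      \<open>\<rho>\<close> is so large that \<open>B\<close> alone gives the same bound on the
      circle of radius \<open>\<rho>\<close>, and that \<open>w\<close> lies inside this
      circle.\<close>
    define C where "C = M ^ n / r"
    have "C > 0" using \<open>M > 0\<close> \<open>r > 0\<close> by (simp add: C_def)
    define \<rho> where "\<rho> = norm w + norm a + \<bar>B\<bar> ^ n / C + 1"
    have \<rho>w: "norm w < \<rho>"
    proof -
      have "\<bar>B\<bar> ^ n / C \<ge> 0" using \<open>C > 0\<close> by simp
      thus ?thesis unfolding \<rho>_def using norm_ge_zero[of a] by linarith
    qed
    have \<rho>a: "\<bar>B\<bar> ^ n / C < \<rho> - norm a"
      using norm_ge_zero[of w] unfolding \<rho>_def by linarith
    define k where "k = (\<lambda>z. h z ^ n / (z - a))"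
    let ?S = "V \<inter> ball 0 \<rho>"
    have a: "z \<noteq> a" if "z \<in> closure V" for z using dist_a[OF that] \<open>r > 0\<close> by auto
    have clS: "closure ?S \<subseteq> closure V" by (simp add: closure_mono)
    have "norm (k w) \<le> C"
    proof (rule maximum_modulus_frontier[of k ?S])
      have "interior ?S \<subseteq> V" "V \<subseteq> closure V" using interior_subset closure_subset by blast+
      hence "\<And>z. z \<in> interior ?S \<Longrightarrow> z - a \<noteq> 0" using a by (metis right_minus_eq subsetD)
      thus "k holomorphic_on interior ?S"
        unfolding k_def using \<open>interior ?S \<subseteq> V\<close>
        by (intro holomorphic_on_divide holomorphic_on_power holomorphic_on_subset[OF hol] holomorphic_intros)
      show "continuous_on (closure ?S) k"
        unfolding k_def using a clS
        by (intro continuous_intros continuous_on_subset[OF cont]) auto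
      show "bounded ?S" by (simp add: bounded_Int)
      show "w \<in> ?S" using \<open>w \<in> V\<close> \<rho>w by simp
      fix z assume z: "z \<in> frontier ?S"
      hence zV: "z \<in> closure V" using clS by (auto simp: frontier_def)
      have "z \<in> frontier V \<or> norm z = \<rho>"
        using z frontier_Int_subset[of V "ball 0 \<rho>"] frontier_ball[of \<rho> "0::complex"] norm_ge_zero[of w] \<rho>w
        by (force simp: sphere_def dist_norm)
      thus "norm (k z) \<le> C"
      proof
        assume "z \<in> frontier V"
        hence "norm (h z) ^ n \<le> M ^ n" by (simp add: front power_mono)
        thus ?thesis unfolding k_def C_def norm_divide norm_power
          using dist_a[OF zV] \<open>r > 0\<close> \<open>M > 0\<close> by (intro frac_le) auto
      next
        assume "norm z = \<rho>"
        hence "\<rho> - norm a \<le> norm (z - a)" using norm_triangle_ineq2[of z a] by simp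
        hence *: "\<bar>B\<bar> ^ n / C \<le> norm (z - a)" using \<rho>a by linarith
        have "norm (h z) ^ n \<le> \<bar>B\<bar> ^ n"
          using bound[OF zV] by (intro power_mono) auto
        also have "\<dots> \<le> C * norm (z - a)" using * \<open>C > 0\<close> by (simp add: field_simps)
        finally show ?thesis unfolding k_def norm_divide norm_power
          using a[OF zV] by (simp add: divide_le_eq)
      qed
    qed
    moreover have "norm (w - a) > 0" using a \<open>w \<in> V\<close> closure_subset by fastforce
    ultimately show ?thesis using \<open>M > 0\<close> \<open>r > 0\<close>
      by (simp add: k_def C_def norm_divide norm_power field_simps)
  qed
  obtain n where "norm (w - a) / r < (norm (h w) / M) ^ n"
    using real_arch_pow[OF q] by blast
  with power_le[of n] show False by simp
qed

text \<open>
  If the image is not dense, then some $b$ at positive distance from $g(W)$ is so close to a boundary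
  point of $g(W)$ that $1/(g-b)$ exceeds inside $W$ its modulus on the level set $|g - b| = s$,
  contradicting the Phragmen-Lindelof principle.
\<close>
lemma component_image_meets_open:
  fixes g :: "complex \<Rightarrow> complex"
  assumes hol: "g holomorphic_on UNIV" and nc: "\<not> g constant_on UNIV"
    and U: "open U" "connected U" and W: "W \<in> components (g -` U)"
    and U': "open U'" "U' \<subseteq> U" "U' \<noteq> {}"
  shows "g ` W \<inter> U' \<noteq> {}"
proof
  assume disj: "g ` W \<inter> U' = {}"
  have contg: "continuous_on A g" for A
    using hol holomorphic_on_imp_continuous_on continuous_on_subset by blast
  have opU: "open (g -` U)" using U(1) contg by (simp add: open_vimage)
  have Wsub: "W \<subseteq> g -` U" and "W \<noteq> {}" and opW: "open W"
    using W opU by (auto simp: in_components_subset in_components_nonempty open_components)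
  \<comment> \<open>The frontier is that of the closure of the image of \<open>W\<close>, so that
    points arbitrarily near \<open>p\<close> lie outside the closure and thus at positive distance
    from the image. It meets \<open>U\<close> because the connected set \<open>U\<close> contains
    points of the closure and, in \<open>U'\<close>, points outside it.\<close>
  have "\<exists>p. p \<in> U \<and> p \<in> frontier (closure (g ` W))"
  proof (rule ccontr)
    assume "\<not> ?thesis"
    hence "U \<inter> frontier (closure (g ` W)) = {}" by blast
    moreover have "U \<inter> closure (g ` W) \<noteq> {}"
      using Wsub \<open>W \<noteq> {}\<close> closure_subset[of "g ` W"] by blast
    moreover have "U - closure (g ` W) \<noteq> {}"
      using U' disj open_Int_closure_eq_empty[OF U'(1), of "g ` W"] by blast
    ultimately show False using connected_Int_frontier[OF U(2)] by blast
  qed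
  then obtain p where p: "p \<in> U" "p \<in> closure (g ` W)" "p \<notin> interior (closure (g ` W))"
    by (auto simp: frontier_def)
  obtain R where R: "R > 0" "ball p R \<subseteq> U" using p(1) U(1) open_contains_ball by blast
  \<comment> \<open>The radii \<open>R / 4\<close> and \<open>s = R / 2\<close> serve two purposes:
    the closed disc of radius \<open>s\<close> about \<open>b\<close> stays inside
    \<open>ball p R\<close>, and an image point within \<open>R / 4\<close> of \<open>p\<close> is
    within \<open>s\<close> of \<open>b\<close>.\<close>
  obtain b where b: "dist p b < R / 4" "b \<notin> closure (g ` W)"
  proof -
    have "\<not> ball p (R / 4) \<subseteq> closure (g ` W)"
      using p(3) R(1) by (meson centre_in_ball divide_pos_pos interior_maximal open_ball subsetD zero_less_numeral)
    then obtain x where "x \<in> ball p (R / 4)" "x \<notin> closure (g ` W)" by (meson subsetI)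
    thus thesis using that[of x] by simp
  qed
  define s where "s = R / 2"
  have s: "s > 0" "cball b s \<subseteq> U"
  proof -
    have "cball b s \<subseteq> ball p R"
    proof
      fix x assume "x \<in> cball b s"
      thus "x \<in> ball p R" using b(1) dist_triangle[of p x b] R(1) by (simp add: s_def)
    qed
    thus "cball b s \<subseteq> U" using R(2) by blast
  qed (use R in \<open>simp add: s_def\<close>)
  obtain \<epsilon> where \<epsilon>: "\<epsilon> > 0" "ball b \<epsilon> \<inter> g ` W = {}"
  proof -
    have "b \<in> - closure (g ` W)" "open (- closure (g ` W))" using b(2) by auto
    then obtain e where "e > 0" "ball b e \<subseteq> - closure (g ` W)" by (meson open_contains_ball)
    thus thesis using that[of e] closure_subset[of "g ` W"] by blast
  qed
  obtain w where w: "w \<in> W" "dist (g w) b < s"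
  proof -
    obtain y where y: "y \<in> g ` W" "dist y p < R / 4"
      using p(2) R(1) by (metis closure_approachable zero_less_divide_iff zero_less_numeral)
    then obtain w where "w \<in> W" "g w = y" by blast
    moreover have "dist y b < s" using y(2) b(1) dist_triangle[of y b p] by (simp add: s_def)
    ultimately show thesis using that by blast
  qed
  define V where "V = W \<inter> g -` ball b s"
  have opV: "open V" unfolding V_def using opW contg by (simp add: open_Int open_vimage)
  have clV: "closure V \<subseteq> g -` cball b s"
    by (intro closure_minimal) (auto simp: V_def intro!: closed_vimage contg)
  have far: "norm (g z - b) \<ge> \<epsilon>" if "z \<in> closure V" for z
  proof -
    have "closed (g -` (- ball b \<epsilon>))" by (intro closed_vimage contg) auto
    moreover have "V \<subseteq> g -` (- ball b \<epsilon>)" using \<epsilon>(2) by (auto simp: V_def)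
    ultimately have "z \<in> g -` (- ball b \<epsilon>)" using that closure_minimal by blast
    thus ?thesis by (simp add: dist_norm norm_minus_commute)
  qed
  \<comment> \<open>A boundary point with \<open>g z\<close> strictly within \<open>s\<close> of
    \<open>b\<close> would lie in \<open>closure W\<close> and in the preimage of \<open>U\<close>.
    Maximality of the component \<open>W\<close> puts it into \<open>W\<close>, hence into the open
    set \<open>V\<close>, which contains none of its boundary points.\<close>
  have front: "norm (g z - b) \<ge> s" if z: "z \<in> frontier V" for z
  proof (rule ccontr)
    assume less: "\<not> ?thesis"
    have "z \<in> g -` U" "z \<in> closure W"
      using z clV s(2) closure_mono[of V W] by (auto simp: frontier_def V_def)
    moreover have "insert z W \<subseteq> closure W"
      using \<open>z \<in> closure W\<close> closure_subset[of W] by simp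
    hence "connected (insert z W)"
      by (rule connected_intermediate_closure[OF in_components_connected[OF W] subset_insertI])
    ultimately have "insert z W \<subseteq> W"
      using components_maximal[OF W, of "insert z W"] Wsub \<open>W \<noteq> {}\<close> by blast
    hence "z \<in> W" by blast
    hence "z \<in> V" using less by (simp add: V_def dist_norm norm_minus_commute)
    with z opV show False by (simp add: frontier_def interior_open)
  qed
  \<comment> \<open>By Liouville \<open>g\<close> leaves the closed disc about \<open>b\<close>. By
    continuity, a whole disc about such a point \<open>a\<close> misses \<open>V\<close>, as the
    Phragmen-Lindelof principle demands.\<close>
  have "\<exists>a. norm (g a - b) > s"
  proof (rule ccontr)
    assume "\<not> ?thesis"
    hence "range g \<subseteq> cball b s" by (auto simp: dist_norm norm_minus_commute not_less)
    hence "g constant_on UNIV"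
      using Liouville_theorem[OF hol] bounded_subset bounded_cball unfolding constant_on_def by metis
    with nc show False ..
  qed
  then obtain a where a: "norm (g a - b) > s" ..
  obtain r where r: "r > 0" "ball a r \<inter> V = {}"
  proof -
    have "open (g -` (- cball b s))" by (intro open_vimage contg) auto
    moreover have "a \<in> g -` (- cball b s)" using a by (simp add: dist_norm norm_minus_commute)
    ultimately obtain e where "e > 0" "ball a e \<subseteq> g -` (- cball b s)" by (meson open_contains_ball)
    thus thesis using that[of e] by (force simp: V_def)
  qed
  have nz: "g z - b \<noteq> 0" if "z \<in> closure V" for z using far[OF that] \<epsilon>(1) by auto
  have "norm (1 / (g w - b)) \<le> 1 / s"
  proof (rule phragmen_lindelof_unbounded[OF opV, where h = "\<lambda>z. 1 / (g z - b)" and B = "1 / \<epsilon>"])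
    show "(\<lambda>z. 1 / (g z - b)) holomorphic_on V"
      using nz closure_subset[of V]
      by (intro holomorphic_on_divide holomorphic_intros holomorphic_on_subset[OF hol]) auto
    show "continuous_on (closure V) (\<lambda>z. 1 / (g z - b))"
      using nz by (intro continuous_intros contg) auto
    show "norm (1 / (g z - b)) \<le> 1 / \<epsilon>" if "z \<in> closure V" for z
      using far[OF that] \<epsilon>(1) by (simp add: norm_divide frac_le)
    show "norm (1 / (g z - b)) \<le> 1 / s" if "z \<in> frontier V" for z
      using front[OF that] s(1) by (simp add: norm_divide frac_le)
    show "w \<in> V" using w by (simp add: V_def dist_commute)
  qed (use s r in auto)
  moreover have "w \<in> closure V" using w closure_subset by (fastforce simp: V_def dist_commute)
  ultimately have "s \<le> norm (g w - b)" using nz s(1) by (simp add: norm_divide field_simps)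
  with w(2) show False by (simp add: dist_norm)
qed

section \<open>Limits of curves along which an entire function converges\<close>

text \<open>The zeros of \<open>f - \<alpha>\<close> are isolated, and on a small circle about
  \<open>w\<close> the continuous modulus attains a positive minimum. A connected set on which
  \<open>f\<close> is closer than \<open>m\<close> to \<open>\<alpha>\<close> therefore cannot cross
  that circle.\<close>

lemma isolating_circle:
  fixes f :: "complex \<Rightarrow> complex"
  assumes hol: "f holomorphic_on UNIV" and nc: "\<not> f constant_on UNIV" and "f w = \<alpha>" "\<rho> > 0"
  obtains e m where "0 < e" "e < \<rho>" "m > 0" "\<And>z. z \<in> sphere w e \<Longrightarrow> m \<le> norm (f z - \<alpha>)"
proof -
  obtain \<beta> where \<beta>: "f \<beta> - \<alpha> \<noteq> 0"
    using nc unfolding constant_on_def by (metis right_minus_eq)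
  have "(\<lambda>z. f z - \<alpha>) holomorphic_on UNIV" by (intro holomorphic_intros hol)
  from isolated_zeros[OF this open_UNIV connected_UNIV UNIV_I _ UNIV_I \<beta>, of w] \<open>f w = \<alpha>\<close>
  obtain r where r: "r > 0" "\<And>z. z \<in> ball w r - {w} \<Longrightarrow> f z - \<alpha> \<noteq> 0"
    by (metis right_minus_eq)
  define e where "e = min r \<rho> / 2"
  have e: "0 < e" "e < r" "e < \<rho>" using r(1) \<open>\<rho> > 0\<close> by (auto simp: e_def)
  have cont: "continuous_on (sphere w e) (\<lambda>z. norm (f z - \<alpha>))"
    by (intro continuous_intros holomorphic_on_imp_continuous_on holomorphic_on_subset[OF hol]) auto
  have "sphere w e \<noteq> {}" using e(1) by simp
  from continuous_attains_inf[OF compact_sphere this cont] obtain x where x: "x \<in> sphere w e"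
    "\<And>z. z \<in> sphere w e \<Longrightarrow> norm (f x - \<alpha>) \<le> norm (f z - \<alpha>)"
    by auto
  have "x \<in> ball w r - {w}" using x(1) e by auto
  hence "norm (f x - \<alpha>) > 0" using r(2) by simp
  thus thesis by (rule that[OF e(1,3) _ x(2)])
qed

text \<open>The distances from \<open>w\<close> to the points of \<open>S\<close> form an interval
  that omits \<open>e\<close>.\<close>

lemma connected_avoiding_sphere:
  fixes S :: "'a::metric_space set"
  assumes "connected S" "S \<inter> sphere w e = {}" "x \<in> S" "dist w x < e"
  shows "S \<subseteq> ball w e"
proof (rule ccontr)
  assume "\<not> S \<subseteq> ball w e"
  then obtain y where y: "y \<in> S" "\<not> dist w y < e" by (metis mem_ball subsetI)
  have "connected (dist w ` S)"
    by (intro connected_continuous_image continuous_intros assms)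
  hence "e \<in> dist w ` S"
    using connectedD_interval[of "dist w ` S" "dist w x" "dist w y" e] assms y by auto
  with assms(2) show False by auto
qed

text \<open>A curve that does not diverge returns to a fixed disc at arbitrarily late times, so it
  accumulates at some \<open>w\<close>, and continuity gives \<open>f w = \<alpha>\<close>.
  Arbitrarily small isolating circles about \<open>w\<close> then trap its tails, which forces
  convergence.\<close>

lemma curve_diverges_or_converges:
  fixes f :: "complex \<Rightarrow> complex" and \<gamma> :: "real \<Rightarrow> complex"
  assumes hol: "f holomorphic_on UNIV" and nc: "\<not> f constant_on UNIV"
    and cont: "continuous_on {0..} \<gamma>" and lim: "((\<lambda>t. f (\<gamma> t)) \<longlongrightarrow> \<alpha>) at_top"
  obtains "filterlim (\<lambda>t. norm (\<gamma> t)) at_top at_top"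
    | w where "f w = \<alpha>" "(\<gamma> \<longlongrightarrow> w) at_top"
proof (cases "filterlim (\<lambda>t. norm (\<gamma> t)) at_top at_top")
  case True
  thus thesis by (rule that(1))
next
  case False
  then obtain K where K: "\<exists>\<^sub>F t in at_top. norm (\<gamma> t) < K"
    by (auto simp: filterlim_at_top not_eventually not_le)
  have "\<exists>t\<ge>real n. norm (\<gamma> t) < K" for n
    using K by (auto simp: frequently_def eventually_at_top_linorder)
  then obtain t where t: "\<And>n. t n \<ge> real n" "\<And>n. norm (\<gamma> (t n)) < K" by metis
  have "\<forall>n. \<gamma> (t n) \<in> cball 0 K" using t(2) by (simp add: less_imp_le)
  then obtain w \<phi> where w: "strict_mono (\<phi> :: nat \<Rightarrow> nat)" "((\<gamma> \<circ> t) \<circ> \<phi>) \<longlonglongrightarrow> w"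
    using compact_cball[of "0::complex" K] unfolding compact_def by (metis comp_apply)
  have t_top: "filterlim t at_top sequentially"
    by (rule filterlim_at_top_mono[OF filterlim_real_sequentially]) (use t in auto)
  have top: "filterlim (\<lambda>n. t (\<phi> n)) at_top sequentially"
    using filterlim_compose[OF t_top filterlim_subseq[OF w(1)]] .
  have "(\<lambda>n. f (\<gamma> (t (\<phi> n)))) \<longlonglongrightarrow> \<alpha>" using filterlim_compose[OF lim top] .
  moreover have "isCont f w" using hol holomorphic_on_imp_continuous_on
      continuous_on_eq_continuous_at by blast
  hence "(\<lambda>n. f (\<gamma> (t (\<phi> n)))) \<longlonglongrightarrow> f w"
    using w(2) isCont_tendsto_compose[of w f] by (simp add: o_def)
  ultimately have fw: "f w = \<alpha>" using LIMSEQ_unique by blast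
  have "(\<gamma> \<longlongrightarrow> w) at_top"
  proof (rule tendstoI)
    fix \<rho> :: real assume "\<rho> > 0"
    then obtain e m where em: "0 < e" "e < \<rho>" "m > 0"
      "\<And>z. z \<in> sphere w e \<Longrightarrow> m \<le> norm (f z - \<alpha>)"
      using isolating_circle[OF hol nc fw] by blast
    obtain T where T: "\<And>t. t \<ge> T \<Longrightarrow> dist (f (\<gamma> t)) \<alpha> < m"
      using tendstoD[OF lim em(3)] by (auto simp: eventually_at_top_linorder)
    \<comment> \<open>The maximum with 0 keeps the tail inside the half-line on which
      \<open>\<gamma>\<close> is continuous.\<close>
    define T' where "T' = max T 0"
    have "eventually (\<lambda>n. T' \<le> t (\<phi> n)) sequentially"
      using top by (simp add: filterlim_at_top)
    moreover have "eventually (\<lambda>n. dist (\<gamma> (t (\<phi> n))) w < e) sequentially"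
      using tendstoD[OF w(2) em(1)] by simp
    ultimately have "eventually (\<lambda>n. T' \<le> t (\<phi> n) \<and> dist (\<gamma> (t (\<phi> n))) w < e) sequentially"
      by eventually_elim auto
    then obtain n where n: "T' \<le> t (\<phi> n)" "dist (\<gamma> (t (\<phi> n))) w < e"
      using eventually_happens'[OF sequentially_bot] by blast
    have "\<gamma> ` {T'..} \<subseteq> ball w e"
    proof (rule connected_avoiding_sphere)
      show "connected (\<gamma> ` {T'..})"
        by (intro connected_continuous_image continuous_on_subset[OF cont]) (auto simp: T'_def)
      show "\<gamma> ` {T'..} \<inter> sphere w e = {}"
        using em(4) T by (fastforce simp: T'_def dist_norm)
      show "\<gamma> (t (\<phi> n)) \<in> \<gamma> ` {T'..}" using n by blast
      show "dist w (\<gamma> (t (\<phi> n))) < e" using n by (simp add: dist_commute)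
    qed
    hence "\<And>s. s \<ge> T' \<Longrightarrow> dist (\<gamma> s) w < \<rho>" using em(2) by (force simp: dist_commute)
    thus "\<forall>\<^sub>F s in at_top. dist (\<gamma> s) w < \<rho>" by (auto simp: eventually_at_top_linorder)
  qed
  with fw show thesis by (rule that(2))
qed

section \<open>Joining infinitely many paths into one curve\<close>

text \<open>The curve runs through \<open>p n\<close> during the time from \<open>n\<close> to
  \<open>n + 1\<close>, so late times see only paths of large index.\<close>

lemma concatenate_paths:
  fixes p :: "nat \<Rightarrow> real \<Rightarrow> 'a::topological_space"
  assumes "\<And>n. path (p n)" and "\<And>n. pathfinish (p n) = pathstart (p (Suc n))"
  obtains \<delta> :: "real \<Rightarrow> 'a" where "continuous_on {0..} \<delta>"
    "\<And>t. t \<ge> 0 \<Longrightarrow> \<delta> t \<in> path_image (p (nat \<lfloor>t\<rfloor>))"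
proof -
  define \<delta> where "\<delta> = (\<lambda>t. p (nat \<lfloor>t\<rfloor>) (frac t))"
  \<comment> \<open>At the right end point the floor has already jumped to \<open>Suc n\<close>;
    there the formula survives because \<open>p n\<close> ends where \<open>p (Suc n)\<close>
    starts.\<close>
  have piece: "\<delta> t = p n (t - real n)" if "t \<in> {real n..real (Suc n)}" for n t
  proof (cases "t = real (Suc n)")
    case True
    thus ?thesis using assms(2)[of n]
      by (simp add: \<delta>_def pathfinish_def pathstart_def frac_def nat_add_distrib)
  next
    case False
    hence "\<lfloor>t\<rfloor> = int n" using that by (simp add: floor_eq_iff)
    thus ?thesis by (simp add: \<delta>_def frac_def)
  qed
  have cont_piece: "continuous_on {real n..real (Suc n)} \<delta>" for n
  proof -
    have "continuous_on {real n..real (Suc n)} (\<lambda>t. p n (t - real n))"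
      using assms(1)[of n] unfolding path_def
      by (rule continuous_on_compose2) (auto intro!: continuous_intros)
    thus ?thesis by (rule continuous_on_eq) (use piece in auto)
  qed
  have cont_upto: "continuous_on {0..real n} \<delta>" for n
  proof (induction n)
    case (Suc n)
    have "{0..real (Suc n)} = {0..real n} \<union> {real n..real (Suc n)}" by auto
    thus ?case using continuous_on_closed_Un[OF _ _ Suc cont_piece[of n]] by simp
  qed simp
  \<comment> \<open>Continuity is local: near a time below \<open>n\<close>, the half-line and the
    interval up to \<open>n\<close> coincide.\<close>
  have "continuous_on {0..} \<delta>"
    unfolding continuous_on_eq_continuous_within
  proof
    fix t :: real assume "t \<in> {0..}"
    obtain n where n: "t < real n" using reals_Archimedean2 by blast
    have "continuous (at t within {0..real n}) \<delta>"
      using cont_upto[of n] \<open>t \<in> {0..}\<close> n by (auto simp: continuous_on_eq_continuous_within)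
    moreover have "at t within {0..real n} = at t within {0..}"
      by (rule at_within_nhd[of t "{..<real n}"]) (use n in auto)
    ultimately show "continuous (at t within {0..}) \<delta>" by simp
  qed
  moreover have "\<delta> t \<in> path_image (p (nat \<lfloor>t\<rfloor>))" for t
    unfolding \<delta>_def path_image_def using frac_lt_1[of t] by (auto simp: less_imp_le)
  ultimately show thesis using that[of \<delta>] by blast
qed

section \<open>The inclusions obtained by mapping a given curve forward\<close>

lemma asymptotic_varietyI:
  fixes \<gamma> :: "real \<Rightarrow> complex"
  assumes "continuous_on {0..} \<gamma>" "filterlim (\<lambda>t. norm (\<gamma> t)) at_top at_top"
    and "((\<lambda>t. f (\<gamma> t)) \<longlongrightarrow> \<alpha>) at_top"
  shows "\<alpha> \<in> asymptotic_variety f"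
  unfolding asymptotic_variety_def by (intro CollectI exI[of _ \<gamma>] conjI assms)

lemma asymptotic_varietyE:
  assumes "\<alpha> \<in> asymptotic_variety f"
  obtains \<gamma> :: "real \<Rightarrow> complex" where "continuous_on {0..} \<gamma>" "filterlim (\<lambda>t. norm (\<gamma> t)) at_top at_top"
    "((\<lambda>t. f (\<gamma> t)) \<longlongrightarrow> \<alpha>) at_top"
  using assms unfolding asymptotic_variety_def by (elim CollectE exE conjE)

text \<open>The image of the curve under \<open>g\<close> either diverges, and is then asymptotic
  for \<open>f\<close>, or converges to some \<open>w\<close> with \<open>f w = \<alpha>\<close>,
  and then \<open>w\<close> is an asymptotic value of \<open>g\<close>.\<close>

lemma asymptotic_variety_comp_subset:
  fixes f g :: "complex \<Rightarrow> complex"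
  assumes f: "f holomorphic_on UNIV" "\<not> f constant_on UNIV"
    and g: "continuous_on UNIV g"
  shows "asymptotic_variety (f \<circ> g) \<subseteq> asymptotic_variety f \<union> f ` asymptotic_variety g"
proof
  fix \<alpha> assume "\<alpha> \<in> asymptotic_variety (f \<circ> g)"
  then obtain \<gamma> :: "real \<Rightarrow> complex" where \<gamma>: "continuous_on {0..} \<gamma>" "filterlim (\<lambda>t. norm (\<gamma> t)) at_top at_top"
      "((\<lambda>t. (f \<circ> g) (\<gamma> t)) \<longlongrightarrow> \<alpha>) at_top"
    by (rule asymptotic_varietyE)
  have cont: "continuous_on {0..} (\<lambda>t. g (\<gamma> t))"
    by (rule continuous_on_compose2[OF g \<gamma>(1)]) auto
  have lim: "((\<lambda>t. f (g (\<gamma> t))) \<longlongrightarrow> \<alpha>) at_top" using \<gamma>(3) by simp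
  show "\<alpha> \<in> asymptotic_variety f \<union> f ` asymptotic_variety g"
  proof (cases rule: curve_diverges_or_converges[OF f cont lim])
    case 1
    thus ?thesis using asymptotic_varietyI[OF cont _ lim] by blast
  next
    case (2 w)
    thus ?thesis using asymptotic_varietyI[OF \<gamma>(1,2) 2(2)] by blast
  qed
qed

lemma image_asymptotic_variety_subset:
  assumes "continuous_on UNIV f"
  shows "f ` asymptotic_variety g \<subseteq> asymptotic_variety (f \<circ> g)"
proof (intro image_subsetI)
  fix \<beta> assume "\<beta> \<in> asymptotic_variety g"
  then obtain \<gamma> :: "real \<Rightarrow> complex" where \<gamma>: "continuous_on {0..} \<gamma>" "filterlim (\<lambda>t. norm (\<gamma> t)) at_top at_top"
      "((\<lambda>t. g (\<gamma> t)) \<longlongrightarrow> \<beta>) at_top"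
    by (rule asymptotic_varietyE)
  have "isCont f \<beta>" using assms by (simp add: continuous_on_eq_continuous_at)
  hence "((\<lambda>t. (f \<circ> g) (\<gamma> t)) \<longlongrightarrow> f \<beta>) at_top"
    unfolding comp_def by (rule isCont_tendsto_compose[OF _ \<gamma>(3)])
  with \<gamma>(1,2) show "f \<beta> \<in> asymptotic_variety (f \<circ> g)" by (rule asymptotic_varietyI)
qed

section \<open>Asymptotic values of \<open>f\<close> persist under composition with
  \<open>g\<close>\<close>

text \<open>\<open>g\<close> is bounded on each closed disc, so large values of \<open>g\<close> are
  taken only outside it.\<close>

lemma filterlim_norm_of_image:
  fixes g :: "complex \<Rightarrow> complex"
  assumes "continuous_on UNIV g" and lim: "filterlim (\<lambda>t. norm (g (\<delta> t))) at_top F"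
  shows "filterlim (\<lambda>t. norm (\<delta> t)) at_top F"
  unfolding filterlim_at_top
proof
  fix K
  have "compact (g ` cball 0 K)"
    using assms(1) by (intro compact_continuous_image) (auto intro: continuous_on_subset)
  hence "bounded (g ` cball 0 K)" by (rule compact_imp_bounded)
  then obtain B where B: "\<And>z. z \<in> cball 0 K \<Longrightarrow> norm (g z) \<le> B"
    unfolding bounded_iff by blast
  have "\<forall>\<^sub>F t in F. B + 1 \<le> norm (g (\<delta> t))" using lim by (simp add: filterlim_at_top)
  thus "\<forall>\<^sub>F t in F. K \<le> norm (\<delta> t)"
  proof eventually_elim
    case (elim t)
    with B[of "\<delta> t"] show ?case by (cases "norm (\<delta> t) \<le> K") auto
  qed
qed

text \<open>Only the tracts of the original curve \<open>\<gamma>\<close> are lifted, not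
  \<open>\<gamma>\<close> itself. Since each tract contains a tail of \<open>\<gamma>\<close>, it is
  unbounded, which is what makes the new curve diverge.\<close>

lemma asymptotic_variety_subset_comp:
  assumes f: "f holomorphic_on UNIV" "\<not> f constant_on UNIV"
    and g: "g holomorphic_on UNIV" "\<not> g constant_on UNIV"
  shows "asymptotic_variety f \<subseteq> asymptotic_variety (f \<circ> g)"
proof
  fix \<alpha> assume "\<alpha> \<in> asymptotic_variety f"
  then obtain \<gamma> :: "real \<Rightarrow> complex" where \<gamma>: "continuous_on {0..} \<gamma>" "filterlim (\<lambda>t. norm (\<gamma> t)) at_top at_top"
      "((\<lambda>t. f (\<gamma> t)) \<longlongrightarrow> \<alpha>) at_top"
    by (rule asymptotic_varietyE)
  have contf: "continuous_on A f" for A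
    using f(1) holomorphic_on_imp_continuous_on continuous_on_subset by blast
  have contg: "continuous_on A g" for A
    using g(1) holomorphic_on_imp_continuous_on continuous_on_subset by blast
  define S where "S = (\<lambda>n::nat. f -` ball \<alpha> (1 / Suc n))"
  have opS: "open (S n)" for n unfolding S_def by (intro open_vimage contf) auto
  have "\<exists>T\<ge>0. \<forall>t\<ge>T. \<gamma> t \<in> S n" for n
  proof -
    have "\<forall>\<^sub>F t in at_top. dist (f (\<gamma> t)) \<alpha> < 1 / Suc n" using tendstoD[OF \<gamma>(3)] by simp
    then obtain T where "\<And>t. t \<ge> T \<Longrightarrow> dist (f (\<gamma> t)) \<alpha> < 1 / Suc n"
      unfolding eventually_at_top_linorder by blast
    hence "\<forall>t\<ge>max T 0. \<gamma> t \<in> S n" unfolding S_def by (simp add: dist_commute)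
    thus ?thesis by (meson max.cobounded2)
  qed
  then obtain T where T: "\<And>n. T n \<ge> 0" "\<And>n t. t \<ge> T n \<Longrightarrow> \<gamma> t \<in> S n" by metis
  \<comment> \<open>This is the tract over the disc of radius \<open>1 / Suc n\<close>: the
    component of \<open>S n\<close> that contains the tail of \<open>\<gamma>\<close> from time
    \<open>T n\<close> on.\<close>
  define U where "U = (\<lambda>n. connected_component_set (S n) (\<gamma> (T n)))"
  have tail: "\<gamma> t \<in> U n" if "t \<ge> T n" for t n
  proof -
    have "connected (\<gamma> ` {T n..})"
      using T(1) by (intro connected_continuous_image continuous_on_subset[OF \<gamma>(1)]) auto
    moreover have "\<gamma> ` {T n..} \<subseteq> S n" using T(2) by auto
    ultimately have "\<gamma> ` {T n..} \<subseteq> U n" unfolding U_def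
      by (intro connected_component_maximal) simp_all
    thus ?thesis using that by blast
  qed
  have opU: "open (U n)" and connU: "connected (U n)" and US: "U n \<subseteq> S n" for n
    using opS unfolding U_def
    by (simp_all add: open_connected_component connected_component_subset)
  \<comment> \<open>At the later of the two times \<open>\<gamma>\<close> lies in both tracts, so
    \<open>U (Suc n)\<close> falls into the component of \<open>S n\<close> that is
    \<open>U n\<close>.\<close>
  have U_dec: "U (Suc n) \<subseteq> U n" for n
  proof -
    let ?t = "max (T n) (T (Suc n))"
    have "1 / real (Suc (Suc n)) \<le> 1 / real (Suc n)" by (simp add: frac_le)
    hence "S (Suc n) \<subseteq> S n" unfolding S_def by (intro vimage_mono subset_ball)
    hence "U (Suc n) \<subseteq> connected_component_set (S n) (\<gamma> ?t)"
      using US[of "Suc n"] connU tail by (intro connected_component_maximal) auto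
    also have "\<dots> = U n"
      using tail[of n ?t] unfolding U_def by (metis connected_component_eq max.cobounded1)
    finally show ?thesis .
  qed
  have U_antimono: "U m \<subseteq> U n" if "n \<le> m" for m n
    using lift_Suc_antimono_le[of U, OF U_dec that] .
  define C where "C = (\<lambda>n. connected_component_set (g -` U n))"
  have C_comp: "C n z \<in> components (g -` U n)" if "g z \<in> U n" for n z
    using that by (auto simp: C_def components_def)
  have "\<exists>z. \<forall>n. g (z n) \<in> U n \<and> z (Suc n) \<in> C n (z n)"
  proof (rule dependent_nat_choice)
    \<comment> \<open>The chain starts from the density of the range of \<open>g\<close>, which is
      the density property for the whole plane as its own preimage.\<close>
    have "(UNIV :: complex set) \<in> components (g -` UNIV)"
      using components_eq_sing_iff[of "UNIV :: complex set"] by auto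
    hence "g ` UNIV \<inter> U 0 \<noteq> {}"
      using component_image_meets_open[OF g open_UNIV connected_UNIV _ opU[of 0]] tail by blast
    thus "\<exists>z. g z \<in> U 0" by blast
  next
    \<comment> \<open>The component through \<open>z n\<close> of the preimage of \<open>U n\<close>
      has an image that meets the smaller tract \<open>U (Suc n)\<close>; a point of the component
      mapped there continues the chain.\<close>
    fix z n assume "g z \<in> U n"
    hence "g ` C n z \<inter> U (Suc n) \<noteq> {}"
      using component_image_meets_open[OF g opU connU C_comp opU U_dec] tail by blast
    thus "\<exists>y. g y \<in> U (Suc n) \<and> y \<in> C n z" by blast
  qed
  then obtain z where z: "\<And>n. g (z n) \<in> U n" "\<And>n. z (Suc n) \<in> C n (z n)" by blast
  have "path_component (C n (z n)) (z n) (z (Suc n))" for n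
  proof -
    have "open (g -` U n)" using opU contg by (simp add: open_vimage)
    hence "path_connected (C n (z n))"
      by (simp add: C_def open_connected_component connected_open_path_connected)
    moreover have "z n \<in> C n (z n)" using z(1) by (simp add: C_def)
    ultimately show ?thesis using z(2) by (simp add: path_connected_component)
  qed
  then obtain p where p: "\<And>n. path (p n)" "\<And>n. path_image (p n) \<subseteq> C n (z n)"
      "\<And>n. pathstart (p n) = z n" "\<And>n. pathfinish (p n) = z (Suc n)"
    unfolding path_component_def by metis
  have join: "pathfinish (p n) = pathstart (p (Suc n))" for n using p by simp
  obtain \<delta> :: "real \<Rightarrow> complex" where \<delta>: "continuous_on {0..} \<delta>"
      "\<And>t. t \<ge> 0 \<Longrightarrow> \<delta> t \<in> path_image (p (nat \<lfloor>t\<rfloor>))"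
    using concatenate_paths[of p, OF p(1) join] by blast
  \<comment> \<open>At time \<open>t\<close> the curve lies in the component chosen at stage
    \<open>nat \<lfloor>t\<rfloor>\<close>, and the tracts decrease.\<close>
  have \<delta>U: "g (\<delta> t) \<in> U n" if "t \<ge> real n" for t n
  proof -
    have "t \<ge> 0" using that by (rule order_trans[rotated]) simp
    have "C k (z k) \<subseteq> g -` U k" for k unfolding C_def by (rule connected_component_subset)
    hence "\<delta> t \<in> g -` U (nat \<lfloor>t\<rfloor>)" using \<delta>(2)[OF \<open>t \<ge> 0\<close>] p(2) by blast
    moreover have "n \<le> nat \<lfloor>t\<rfloor>" using that by (simp add: le_nat_floor)
    ultimately show ?thesis using U_antimono by blast
  qed
  have lim: "((\<lambda>t. f (g (\<delta> t))) \<longlongrightarrow> \<alpha>) at_top"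
  proof (rule tendstoI)
    fix e :: real assume "e > 0"
    then obtain n where n: "1 / Suc n < e" by (metis nat_approx_posE of_nat_Suc)
    have "dist (f (g (\<delta> t))) \<alpha> < e" if "t \<ge> real n" for t
      using \<delta>U[OF that] US[of n] n by (force simp: S_def dist_commute)
    thus "\<forall>\<^sub>F t in at_top. dist (f (g (\<delta> t))) \<alpha> < e" by (auto simp: eventually_at_top_linorder)
  qed
  have cont: "continuous_on {0..} (\<lambda>t. g (\<delta> t))"
    by (rule continuous_on_compose2[OF contg \<delta>(1)]) auto
  \<comment> \<open>If \<open>g\<close> tended to some \<open>w\<close> along
    \<open>\<delta>\<close>, an isolating circle about \<open>w\<close> would enclose a whole tract
    \<open>U n\<close>, since the tract avoids the circle and has a point inside. But
    \<open>U n\<close> contains a tail of \<open>\<gamma>\<close>, which is unbounded.\<close>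
  have "filterlim (\<lambda>t. norm (g (\<delta> t))) at_top at_top"
  proof (cases rule: curve_diverges_or_converges[OF f cont lim])
    case (2 w)
    obtain e m where em: "0 < e" "m > 0" "\<And>z. z \<in> sphere w e \<Longrightarrow> m \<le> norm (f z - \<alpha>)"
      using isolating_circle[OF f 2(1) zero_less_one] by metis
    obtain n where n: "1 / Suc n < m" using em(2) by (metis nat_approx_posE of_nat_Suc)
    have "\<forall>\<^sub>F t in at_top. dist (g (\<delta> t)) w < e \<and> t \<ge> real n"
      using tendstoD[OF 2(2) em(1)] eventually_ge_at_top by (rule eventually_conj)
    then obtain t where t: "dist (g (\<delta> t)) w < e" "t \<ge> real n"
      using eventually_happens'[OF trivial_limit_at_top_linorder] by blast
    have sub: "U n \<subseteq> ball w e"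
    proof (rule connected_avoiding_sphere[OF connU])
      show "U n \<inter> sphere w e = {}"
        using US[of n] em(3) n by (force simp: S_def dist_norm norm_minus_commute)
      show "g (\<delta> t) \<in> U n" using \<delta>U t by blast
      show "dist w (g (\<delta> t)) < e" using t by (simp add: dist_commute)
    qed
    have "\<forall>\<^sub>F t in at_top. norm (\<gamma> t) \<ge> norm w + e \<and> t \<ge> T n"
      using \<gamma>(2) eventually_ge_at_top by (intro eventually_conj) (auto simp: filterlim_at_top)
    then obtain s where s: "norm (\<gamma> s) \<ge> norm w + e" "s \<ge> T n"
      using eventually_happens'[OF trivial_limit_at_top_linorder] by blast
    have "dist w (\<gamma> s) < e" using tail[OF s(2)] sub by auto
    hence False using s(1) norm_triangle_ineq2[of "\<gamma> s" w] by (simp add: dist_norm norm_minus_commute)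
    thus ?thesis ..
  qed
  hence "filterlim (\<lambda>t. norm (\<delta> t)) at_top at_top" by (rule filterlim_norm_of_image[OF contg])
  with \<delta>(1) lim show "\<alpha> \<in> asymptotic_variety (f \<circ> g)"
    by (intro asymptotic_varietyI) simp_all
qed

section \<open>Equality of the two sets for functions in \<open>elh\<close>\<close>

lemma elh_nonconstant: "f \<in> elh \<Longrightarrow> \<not> f constant_on UNIV"
proof
  assume "f \<in> elh" "f constant_on UNIV"
  then obtain c where "f = (\<lambda>_. c)" by (auto simp: constant_on_def)
  with \<open>f \<in> elh\<close> show False by (simp add: elh_def)
qed

theorem theorem3p8:
  fixes f g :: "complex \<Rightarrow> complex"
  assumes "f \<in> elh" and "g \<in> elh"
  shows "asymptotic_variety (f \<circ> g) = asymptotic_variety f \<union> f ` asymptotic_variety g"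
proof -
  have f: "f holomorphic_on UNIV" "\<not> f constant_on UNIV"
    and g: "g holomorphic_on UNIV" "\<not> g constant_on UNIV"
    using assms elh_nonconstant by (auto simp: elh_def)
  note cont = f(1)[THEN holomorphic_on_imp_continuous_on] g(1)[THEN holomorphic_on_imp_continuous_on]
  show ?thesis
    using asymptotic_variety_comp_subset[OF f cont(2)] asymptotic_variety_subset_comp[OF f g]
      image_asymptotic_variety_subset[OF cont(1), of g] by blast
qed

end
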